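(* Let $A$ (written multiplicatively) and $B$ (written additively) be abelian groups, and let $\mathcal{C}$ be a group-like monoidal 2-category with invariants $\pi_0(\mathcal{C})=B$, $\pi_1(\mathcal{C})=0$, $\pi_2(\mathcal{C})=A$ and trivial action of $B$ on $A$, defined by a normalized $A$-valued 4-cocycle $f(x_1,x_2,x_3,x_4)$ on $B$, for which the condition $$\prod_{\sigma\in\Sigma_4}f^{\sigma}(x_1,x_2,x_3,x_4)^{\epsilon(\sigma)}=1$$ is satisfied for all $x_i\in B$. Here $f^{\sigma}(x_1,x_2,x_3,x_4)=f(x_{\sigma^{-1}(1)},x_{\sigma^{-1}(2)},x_{\sigma^{-1}(3)},x_{\sigma^{-1}(4)})$ (so $x_i$ is placed in position $\sigma(i)$) and $\epsilon(\sigma)$ is the sign of $\sigma$. Define \begin{align*} g(x_1,x_2;x_3\mid_2x_4)&=\prod_{\sigma(1)<\sigma(2)}f^{\sigma}(x_1,x_2,x_3,x_4)^{-\epsilon(\sigma)},\\ h(x_1;x_2,x_3\mid_2x_4)&=\prod_{\sigma(2)<\sigma(3)}f^{\sigma}(x_1,x_2,x_3,x_4)^{\epsilon(\sigma)},\\ \gamma(x_1\mid_2x_2,x_3;x_4)&=h(x_1;x_2,x_3\mid_2x_4),\\ \eta(x_1\mid_2x_2;x_3,x_4)&=\prod_{\sigma(3)<\sigma(4)}f^{\sigma}(x_1,x_2,x_3,x_4)^{-\epsilon(\sigma)}, \end{align*} the products being over the $\sigma\in\Sigma_4$ satisfying the indicated inequality. Then the triples $$(g(x_1,x_2;x_3\mid_2x_4),\,h(x_1;x_2,x_3\mid_2x_4),\,1)\quad\text{and}\quad(\gamma(x_1\mid_2x_2,x_3;x_4),\,\eta(x_1\mid_2x_2;x_3,x_4),\,1)$$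 respectively determine, for every fixed $x_4\in B$ and every fixed $x_1\in B$, a biextension structure. Together they define an alternating triextension of $B\times B\times B$ by $A$.
   Context: $\Sigma_4$ is the symmetric group. The 4-cocycle $f$ classifies $\mathcal{C}$ via its class in $H^4(B,A)$ (trivial coefficients); it is obtained by choosing representative objects $X_x$ for $x\in B$, 1-arrows $c_{x,y}:X_xX_y\to X_{x+y}$ and 2-arrows $\eta_{x,y,z}$ filling the associativity diagrams relating the two ways of going from $X_x(X_yX_z)$ to $X_{x+y+z}$, and comparing them through the pentagon 2-arrows. Biextension on the trivial torsor: a pair of maps $G(b_1,b_2;b')$, $H(b;b_1',b_2')$ from $B^3$ to $A$ determines a biextension structure on $A\times B\times B$ by $(a_1,b_1,b')\stackrel{1}{+}(a_2,b_2,b')=(a_1a_2G(b_1,b_2;b'),b_1+b_2,b')$ and $(a_1,b,b_1')\stackrel{2}{+}(a_2,b,b_2')=(a_1a_2H(b;b_1',b_2'),b,b_1'+b_2')$ when both laws are associative, commutative, and compatible (interchange law), i.e. $G(-,-;b')$ and $H(b;-,-)$ are symmetric 2-cocycles and $\dfrac{H(b_1+b_2;b_1',b_2')}{H(b_1;b_1',b_2')H(b_2;b_1',b_2')}=\dfrac{G(b_1,b_2;b_1'+b_2')}{G(b_1,b_2;b_1')G(b_1,b_2;b_2')}$. The third term $1$ of each triple is the constant map $u:B\to A$ with value $1$, describing an alternating structure on the biextension: a triple $(G,H,u)$ describes the alternating structure given by the section $u$ above the diagonal (for the definition, see below). Triextension: an $A$-torsor $E$ on $B^3$ with three partial laws,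 one in each variable, each associative and commutative, any two compatible (interchange law). Here the torsor is $A\times B^3$, and the laws are given by: $\stackrel{1}{+}$ of elements above $(x_1,x_3,x_4)$ and $(x_2,x_3,x_4)$ via $g(x_1,x_2;x_3\mid_2x_4)$; $\stackrel{2}{+}$ of elements above $(x_1,x_2,x_4)$ and $(x_1,x_3,x_4)$ via $h(x_1;x_2,x_3\mid_2x_4)=\gamma(x_1\mid_2x_2,x_3;x_4)$; $\stackrel{3}{+}$ of elements above $(x_1,x_2,x_3)$ and $(x_1,x_2,x_4)$ via $\eta(x_1\mid_2x_2;x_3,x_4)$. Alternating structure on a biextension $F$ of $B\times B$ by $A$ (juxtaposition denotes contracted product of torsors): bimultiplicativity gives canonical isomorphisms $F_{x+y,x+y}\simeq F_{x,x}F_{x,y}F_{y,x}F_{y,y}$, hence on the diagonal restriction $\Delta F$ canonical isomorphisms $\sigma_x:\Delta F_{-x}\to\Delta F_x$ and $\Delta F_{x+y+z}\Delta F_x\Delta F_y\Delta F_z\simeq\Delta F_{x+y}\Delta F_{x+z}\Delta F_{y+z}$; an alternating structure is a section $t(x)\in F_{x,x}$ with $\sigma_x(t(-x))=t(x)$ and $t(x+y+z)t(x)t(y)t(z)$ corresponding to $t(x+y)t(x+z)t(y+z)$. Alternating triextension: a triextension $E$ with sections $t^1_{x,z}\in E_{x,x,z}$ and $t^2_{x,z}\in E_{x,z,z}$ such that: for each $z$, $t^1_{\cdot,z}$ is an alternating structure on the biextension $(x,y)\mapsto E_{x,y,z}$, and $t^1_{x,z}\stackrel{3}{+}t^1_{x,z'}=t^1_{x,z+z'}$;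 for each $x$, $t^2_{x,\cdot}$ is an alternating structure on $(y,z)\mapsto E_{x,y,z}$, and $t^2_{x,z}\stackrel{1}{+}t^2_{x',z}=t^2_{x+x',z}$; $t^1_{x,x}=t^2_{x,x}$ in $E_{x,x,x}$; and $s^1_{x,y,x}(t^2_{y,x})^{-1}=s^2_{x,y,x}(t^1_{x,y})^{-1}$ in $E_{x,y,x}$, where (via canonical isomorphisms) $s^1_{x,y,z}=t^1_{x+y,z}(t^1_{x,z})^{-1}(t^1_{y,z})^{-1}\in E_{x,y,z}E_{y,x,z}$ and $s^2_{x,y,z}=t^2_{x,y+z}(t^2_{x,y})^{-1}(t^2_{x,z})^{-1}\in E_{x,y,z}E_{x,z,y}$. Here $t^1$ and $t^2$ are the sections of the trivial torsor given by the constant map $1$. *)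

theory Defs
  imports Main "HOL-Combinatorics.Permutations"
begin

text \<open>
  Both abelian groups are types of class \<open>ab_group_add\<close>. In particular the coefficient group \<open>A\<close>
  is written additively: products in \<open>A\<close> become sums, inverses become negatives and the constant
  section \<open>1\<close> becomes \<open>0\<close>.
\<close>

section \<open>Torsors and partial composition laws\<close>

locale torsor_over =
  fixes E :: "'e set"
    and act :: "'a::ab_group_add \<Rightarrow> 'e \<Rightarrow> 'e"
    and base :: "'e \<Rightarrow> 's"
  assumes act_closed: "e \<in> E \<Longrightarrow> act a e \<in> E"
    and base_act: "e \<in> E \<Longrightarrow> base (act a e) = base e"
    and act_zero: "e \<in> E \<Longrightarrow> act 0 e = e"
    and act_add: "e \<in> E \<Longrightarrow> act (a + a') e = act a (act a' e)"
    and fibre_nonempty: "\<exists>e\<in>E. base e = s"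
    and simply_transitive:
      "e \<in> E \<Longrightarrow> e' \<in> E \<Longrightarrow> base e = base e' \<Longrightarrow> \<exists>!a. act a e = e'"
begin

text \<open>
  A partial law \<open>add\<close> lies over a partial operation \<open>cmp\<close> on the base: \<open>add e e'\<close> is meaningful
  when \<open>cmp (base e) (base e') = Some s\<close>, and then lies above \<open>s\<close>. The second conjunct says that
  \<open>add\<close> is a map on the contracted product of the two fibres; together with associativity and
  commutativity it makes \<open>add\<close> an abelian group law where \<open>cmp\<close> is one.
\<close>

definition partial_law :: "('s \<Rightarrow> 's \<Rightarrow> 's option) \<Rightarrow> ('e \<Rightarrow> 'e \<Rightarrow> 'e) \<Rightarrow> bool" where
  "partial_law cmp add \<longleftrightarrow>
     (\<forall>e\<in>E. \<forall>e'\<in>E. \<forall>s. cmp (base e) (base e') = Some s \<longrightarrow>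
        add e e' \<in> E \<and> base (add e e') = s) \<and>
     (\<forall>e\<in>E. \<forall>e'\<in>E. \<forall>a a'. cmp (base e) (base e') \<noteq> None \<longrightarrow>
        add (act a e) (act a' e') = act (a + a') (add e e')) \<and>
     (\<forall>e\<in>E. \<forall>e'\<in>E. \<forall>e''\<in>E.
        cmp (base e) (base e') \<noteq> None \<longrightarrow> cmp (base e') (base e'') \<noteq> None \<longrightarrow>
        add (add e e') e'' = add e (add e' e'')) \<and>
     (\<forall>e\<in>E. \<forall>e'\<in>E. cmp (base e) (base e') \<noteq> None \<longrightarrow> add e e' = add e' e)"

definition interchange ::
  "('s \<Rightarrow> 's \<Rightarrow> 's option) \<Rightarrow> ('e \<Rightarrow> 'e \<Rightarrow> 'e) \<Rightarrow> ('s \<Rightarrow> 's \<Rightarrow> 's option) \<Rightarrow> ('e \<Rightarrow> 'e \<Rightarrow> 'e) \<Rightarrow> bool" where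
  "interchange cmp add cmp' add' \<longleftrightarrow>
     (\<forall>e11\<in>E. \<forall>e12\<in>E. \<forall>e21\<in>E. \<forall>e22\<in>E.
        cmp (base e11) (base e21) \<noteq> None \<longrightarrow> cmp (base e12) (base e22) \<noteq> None \<longrightarrow>
        cmp' (base e11) (base e12) \<noteq> None \<longrightarrow> cmp' (base e21) (base e22) \<noteq> None \<longrightarrow>
        add' (add e11 e21) (add e12 e22) = add (add' e11 e12) (add' e21 e22))"

text \<open>
  \<open>cprod [e\<^sub>1, \<dots>, e\<^sub>n]\<close> is the element \<open>e\<^sub>1 \<dots> e\<^sub>n\<close> of the contracted product of the fibres through
  \<open>e\<^sub>1, \<dots>, e\<^sub>n\<close>, i.e. the orbit of the tuple under the tuples of \<open>A\<^sup>n\<close> with sum \<open>0\<close>;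
  \<open>cdiv c e\<close> is \<open>c e\<^sup>-\<^sup>1\<close>, for \<open>c\<close> in a contracted product of two fibres, the second being that of \<open>e\<close>.
\<close>

definition cprod :: "'e list \<Rightarrow> 'e list set" where
  "cprod es = {map2 act as es | as. length as = length es \<and> sum_list as = 0}"

definition cdiv :: "'e list set \<Rightarrow> 'e \<Rightarrow> 'e" where
  "cdiv c e = (THE d. d \<in> E \<and> c = cprod [d, e])"

end

section \<open>Biextensions\<close>

definition pair_comp1 :: "'b::ab_group_add \<times> 'b \<Rightarrow> 'b \<times> 'b \<Rightarrow> ('b \<times> 'b) option" where
  "pair_comp1 = (\<lambda>(x, y) (x', y'). if y = y' then Some (x + x', y) else None)"

definition pair_comp2 :: "'b::ab_group_add \<times> 'b \<Rightarrow> 'b \<times> 'b \<Rightarrow> ('b \<times> 'b) option" where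
  "pair_comp2 = (\<lambda>(x, y) (x', y'). if x = x' then Some (x, y + y') else None)"

locale biextension = torsor_over E act base
  for E :: "'e set"
    and act :: "'a::ab_group_add \<Rightarrow> 'e \<Rightarrow> 'e"
    and base :: "'e \<Rightarrow> 'b::ab_group_add \<times> 'b" +
  fixes add1 add2 :: "'e \<Rightarrow> 'e \<Rightarrow> 'e"
  assumes law1: "partial_law pair_comp1 add1"
    and law2: "partial_law pair_comp2 add2"
    and laws_compatible: "interchange pair_comp1 add1 pair_comp2 add2"
begin

definition fib :: "'b \<Rightarrow> 'b \<Rightarrow> 'e set" where
  "fib x y = {e \<in> E. base e = (x, y)}"

definition zero1 :: "'b \<Rightarrow> 'e" where
  "zero1 y = (THE e. e \<in> fib 0 y \<and> add1 e e = e)"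

definition zero2 :: "'b \<Rightarrow> 'e" where
  "zero2 x = (THE e. e \<in> fib x 0 \<and> add2 e e = e)"

definition neg1 :: "'e \<Rightarrow> 'e" where
  "neg1 e = (THE e'. e' \<in> fib (- fst (base e)) (snd (base e)) \<and> add1 e e' = zero1 (snd (base e)))"

definition neg2 :: "'e \<Rightarrow> 'e" where
  "neg2 e = (THE e'. e' \<in> fib (fst (base e)) (- snd (base e)) \<and> add2 e e' = zero2 (fst (base e)))"

text \<open>
  The canonical isomorphism \<open>\<sigma>\<^sub>x\<close> from the fibre over \<open>(-x, -x)\<close> to the one over \<open>(x, x)\<close>: the
  composite of the anti-isomorphisms given by the inverses for the two group laws.
\<close>

definition diag_neg :: "'e \<Rightarrow> 'e" where
  "diag_neg e = neg2 (neg1 e)"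

text \<open>
  \<open>sum4\<close> is the canonical isomorphism from the contracted product of the four fibres over
  \<open>(x, x)\<close>, \<open>(x, y)\<close>, \<open>(y, x)\<close>, \<open>(y, y)\<close> to the fibre over \<open>(x + y, x + y)\<close>, and \<open>sum9\<close> is its
  analogue for three summands.
\<close>

definition sum4 :: "'e \<Rightarrow> 'e \<Rightarrow> 'e \<Rightarrow> 'e \<Rightarrow> 'e" where
  "sum4 e11 e12 e21 e22 = add1 (add2 e11 e12) (add2 e21 e22)"

definition sum9 :: "'e \<Rightarrow> 'e \<Rightarrow> 'e \<Rightarrow> 'e \<Rightarrow> 'e \<Rightarrow> 'e \<Rightarrow> 'e \<Rightarrow> 'e \<Rightarrow> 'e \<Rightarrow> 'e" where
  "sum9 e11 e12 e13 e21 e22 e23 e31 e32 e33 =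
     add1 (add1 (add2 (add2 e11 e12) e13) (add2 (add2 e21 e22) e23)) (add2 (add2 e31 e32) e33)"

text \<open>
  The graph of the canonical isomorphism
  \<open>\<Delta>F\<^bsub>x+y+z\<^esub> \<Delta>F\<^bsub>x\<^esub> \<Delta>F\<^bsub>y\<^esub> \<Delta>F\<^bsub>z\<^esub> \<simeq> \<Delta>F\<^bsub>x+y\<^esub> \<Delta>F\<^bsub>x+z\<^esub> \<Delta>F\<^bsub>y+z\<^esub>\<close>: after decomposition both sides are the
  product of the fibres over all pairs of \<open>x, y, z\<close>, those over \<open>(x, x)\<close>, \<open>(y, y)\<close>, \<open>(z, z)\<close>
  occurring twice. Since everything is equivariant, each choice of elements in these fibres
  determines the same isomorphism of torsors.
\<close>

definition cube_iso :: "'b \<Rightarrow> 'b \<Rightarrow> 'b \<Rightarrow> ('e list set \<times> 'e list set) set" where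
  "cube_iso x y z =
     {(cprod [sum9 exx exy exz eyx eyy eyz ezx ezy ezz, exx', eyy', ezz'],
       cprod [sum4 exx exy eyx eyy, sum4 exx' exz ezx ezz, sum4 eyy' eyz ezy ezz'])
      | exx exx' exy exz eyx eyy eyy' eyz ezx ezy ezz ezz'.
        exx \<in> fib x x \<and> exx' \<in> fib x x \<and> exy \<in> fib x y \<and> exz \<in> fib x z \<and>
        eyx \<in> fib y x \<and> eyy \<in> fib y y \<and> eyy' \<in> fib y y \<and> eyz \<in> fib y z \<and>
        ezx \<in> fib z x \<and> ezy \<in> fib z y \<and> ezz \<in> fib z z \<and> ezz' \<in> fib z z}"

end

locale alternating_biextension = biextension E act base add1 add2
  for E :: "'e set"
    and act :: "'a::ab_group_add \<Rightarrow> 'e \<Rightarrow> 'e"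
    and base :: "'e \<Rightarrow> 'b::ab_group_add \<times> 'b"
    and add1 add2 :: "'e \<Rightarrow> 'e \<Rightarrow> 'e" +
  fixes t :: "'b \<Rightarrow> 'e"
  assumes t_section: "t x \<in> fib x x"
    and t_neg: "diag_neg (t (- x)) = t x"
    and t_cube:
      "(cprod [t (x + y + z), t x, t y, t z], cprod [t (x + y), t (x + z), t (y + z)])
         \<in> cube_iso x y z"

section \<open>Triextensions\<close>

definition triple_comp1 :: "'b::ab_group_add \<times> 'b \<times> 'b \<Rightarrow> 'b \<times> 'b \<times> 'b \<Rightarrow> ('b \<times> 'b \<times> 'b) option" where
  "triple_comp1 = (\<lambda>(x, y, z) (x', y', z').
     if y = y' \<and> z = z' then Some (x + x', y, z) else None)"

definition triple_comp2 :: "'b::ab_group_add \<times> 'b \<times> 'b \<Rightarrow> 'b \<times> 'b \<times> 'b \<Rightarrow> ('b \<times> 'b \<times> 'b) option" where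
  "triple_comp2 = (\<lambda>(x, y, z) (x', y', z').
     if x = x' \<and> z = z' then Some (x, y + y', z) else None)"

definition triple_comp3 :: "'b::ab_group_add \<times> 'b \<times> 'b \<Rightarrow> 'b \<times> 'b \<times> 'b \<Rightarrow> ('b \<times> 'b \<times> 'b) option" where
  "triple_comp3 = (\<lambda>(x, y, z) (x', y', z').
     if x = x' \<and> y = y' then Some (x, y, z + z') else None)"

locale triextension = torsor_over E act base
  for E :: "'e set"
    and act :: "'a::ab_group_add \<Rightarrow> 'e \<Rightarrow> 'e"
    and base :: "'e \<Rightarrow> 'b::ab_group_add \<times> 'b \<times> 'b" +
  fixes add1 add2 add3 :: "'e \<Rightarrow> 'e \<Rightarrow> 'e"
  assumes law1: "partial_law triple_comp1 add1"
    and law2: "partial_law triple_comp2 add2"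
    and law3: "partial_law triple_comp3 add3"
    and laws_compatible12: "interchange triple_comp1 add1 triple_comp2 add2"
    and laws_compatible13: "interchange triple_comp1 add1 triple_comp3 add3"
    and laws_compatible23: "interchange triple_comp2 add2 triple_comp3 add3"
begin

definition fib :: "'b \<Rightarrow> 'b \<Rightarrow> 'b \<Rightarrow> 'e set" where
  "fib x y z = {e \<in> E. base e = (x, y, z)}"

text \<open>
  \<open>s1 t1 x y z\<close> is the element \<open>t1 (x + y) z (t1 x z)\<^sup>-\<^sup>1 (t1 y z)\<^sup>-\<^sup>1\<close> of \<open>E\<^bsub>x,y,z\<^esub> E\<^bsub>y,x,z\<^esub>\<close>, the quotient
  being taken through the canonical decomposition of \<open>E\<^bsub>x+y,x+y,z\<^esub>\<close>; similarly \<open>s2 t2 x y z\<close> is the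
  element \<open>t2 x (y + z) (t2 x y)\<^sup>-\<^sup>1 (t2 x z)\<^sup>-\<^sup>1\<close> of \<open>E\<^bsub>x,y,z\<^esub> E\<^bsub>x,z,y\<^esub>\<close>.
\<close>

definition s1 :: "('b \<Rightarrow> 'b \<Rightarrow> 'e) \<Rightarrow> 'b \<Rightarrow> 'b \<Rightarrow> 'b \<Rightarrow> 'e list set" where
  "s1 t1 x y z = (THE c. \<exists>u\<in>fib x y z. \<exists>v\<in>fib y x z.
     c = cprod [u, v] \<and> t1 (x + y) z = add1 (add2 (t1 x z) u) (add2 v (t1 y z)))"

definition s2 :: "('b \<Rightarrow> 'b \<Rightarrow> 'e) \<Rightarrow> 'b \<Rightarrow> 'b \<Rightarrow> 'b \<Rightarrow> 'e list set" where
  "s2 t2 x y z = (THE c. \<exists>u\<in>fib x y z. \<exists>v\<in>fib x z y.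
     c = cprod [u, v] \<and> t2 x (y + z) = add2 (add3 (t2 x y) u) (add3 v (t2 x z)))"

end

locale alternating_triextension = triextension E act base add1 add2 add3
  for E :: "'e set"
    and act :: "'a::ab_group_add \<Rightarrow> 'e \<Rightarrow> 'e"
    and base :: "'e \<Rightarrow> 'b::ab_group_add \<times> 'b \<times> 'b"
    and add1 add2 add3 :: "'e \<Rightarrow> 'e \<Rightarrow> 'e" +
  fixes t1 t2 :: "'b \<Rightarrow> 'b \<Rightarrow> 'e"
  assumes t1_section: "t1 x z \<in> fib x x z"
    and t2_section: "t2 x z \<in> fib x z z"
    and t1_alternating:
      "alternating_biextension {e \<in> E. snd (snd (base e)) = z} act
         (\<lambda>e. (fst (base e), fst (snd (base e)))) add1 add2 (\<lambda>x. t1 x z)"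
    and t1_additive: "add3 (t1 x z) (t1 x z') = t1 x (z + z')"
    and t2_alternating:
      "alternating_biextension {e \<in> E. fst (base e) = x} act
         (\<lambda>e. snd (base e)) add2 add3 (\<lambda>z. t2 x z)"
    and t2_additive: "add1 (t2 x z) (t2 x' z) = t2 (x + x') z"
    and t1_t2_diag: "t1 x x = t2 x x"
    and s1_s2: "cdiv (s1 t1 x y x) (t2 y x) = cdiv (s2 t2 x y x) (t1 x y)"

section \<open>Structures on trivial torsors\<close>

definition triv_act :: "'a::ab_group_add \<Rightarrow> 'a \<times> 's \<Rightarrow> 'a \<times> 's" where
  "triv_act a = (\<lambda>(a', s). (a + a', s))"

definition triv_bi1 ::
  "('b \<Rightarrow> 'b \<Rightarrow> 'b \<Rightarrow> 'a) \<Rightarrow> 'a::ab_group_add \<times> 'b::ab_group_add \<times> 'b \<Rightarrow> 'a \<times> 'b \<times> 'b \<Rightarrow> 'a \<times> 'b \<times> 'b" where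
  "triv_bi1 G = (\<lambda>(a1, b1, b') (a2, b2, _). (a1 + a2 + G b1 b2 b', b1 + b2, b'))"

definition triv_bi2 ::
  "('b \<Rightarrow> 'b \<Rightarrow> 'b \<Rightarrow> 'a) \<Rightarrow> 'a::ab_group_add \<times> 'b::ab_group_add \<times> 'b \<Rightarrow> 'a \<times> 'b \<times> 'b \<Rightarrow> 'a \<times> 'b \<times> 'b" where
  "triv_bi2 H = (\<lambda>(a1, b, b1') (a2, _, b2'). (a1 + a2 + H b b1' b2', b, b1' + b2'))"

text \<open>The triple \<open>(G, H, u)\<close> determines a biextension structure, with alternating section \<open>u\<close>.\<close>

definition determines_biextension ::
  "('b \<Rightarrow> 'b \<Rightarrow> 'b \<Rightarrow> 'a) \<Rightarrow> ('b \<Rightarrow> 'b \<Rightarrow> 'b \<Rightarrow> 'a) \<Rightarrow> ('b::ab_group_add \<Rightarrow> 'a::ab_group_add) \<Rightarrow> bool" where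
  "determines_biextension G H u \<longleftrightarrow>
     alternating_biextension UNIV triv_act snd (triv_bi1 G) (triv_bi2 H) (\<lambda>b. (u b, b, b))"

definition triv_tri1 ::
  "('b \<Rightarrow> 'b \<Rightarrow> 'b \<Rightarrow> 'b \<Rightarrow> 'a) \<Rightarrow>
    'a::ab_group_add \<times> 'b::ab_group_add \<times> 'b \<times> 'b \<Rightarrow> 'a \<times> 'b \<times> 'b \<times> 'b \<Rightarrow> 'a \<times> 'b \<times> 'b \<times> 'b" where
  "triv_tri1 c = (\<lambda>(a, x1, x3, x4) (a', x2, _, _). (a + a' + c x1 x2 x3 x4, x1 + x2, x3, x4))"

definition triv_tri2 ::
  "('b \<Rightarrow> 'b \<Rightarrow> 'b \<Rightarrow> 'b \<Rightarrow> 'a) \<Rightarrow>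
    'a::ab_group_add \<times> 'b::ab_group_add \<times> 'b \<times> 'b \<Rightarrow> 'a \<times> 'b \<times> 'b \<times> 'b \<Rightarrow> 'a \<times> 'b \<times> 'b \<times> 'b" where
  "triv_tri2 c = (\<lambda>(a, x1, x2, x4) (a', _, x3, _). (a + a' + c x1 x2 x3 x4, x1, x2 + x3, x4))"

definition triv_tri3 ::
  "('b \<Rightarrow> 'b \<Rightarrow> 'b \<Rightarrow> 'b \<Rightarrow> 'a) \<Rightarrow>
    'a::ab_group_add \<times> 'b::ab_group_add \<times> 'b \<times> 'b \<Rightarrow> 'a \<times> 'b \<times> 'b \<times> 'b \<Rightarrow> 'a \<times> 'b \<times> 'b \<times> 'b" where
  "triv_tri3 c = (\<lambda>(a, x1, x2, x3) (a', _, _, x4). (a + a' + c x1 x2 x3 x4, x1, x2, x3 + x4))"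

section \<open>Four-cocycles and their partial antisymmetrizations\<close>

definition normalized_4cocycle ::
  "('b::ab_group_add \<Rightarrow> 'b \<Rightarrow> 'b \<Rightarrow> 'b \<Rightarrow> 'a::ab_group_add) \<Rightarrow> bool" where
  "normalized_4cocycle f \<longleftrightarrow>
     (\<forall>x1 x2 x3 x4 x5.
        f x2 x3 x4 x5 - f (x1 + x2) x3 x4 x5 + f x1 (x2 + x3) x4 x5
          - f x1 x2 (x3 + x4) x5 + f x1 x2 x3 (x4 + x5) - f x1 x2 x3 x4 = 0) \<and>
     (\<forall>x y z. f 0 x y z = 0 \<and> f x 0 y z = 0 \<and> f x y 0 z = 0 \<and> f x y z 0 = 0)"

definition permuted ::
  "('b \<Rightarrow> 'b \<Rightarrow> 'b \<Rightarrow> 'b \<Rightarrow> 'a) \<Rightarrow> (nat \<Rightarrow> nat) \<Rightarrow> 'b \<Rightarrow> 'b \<Rightarrow> 'b \<Rightarrow> 'b \<Rightarrow> 'a" where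
  "permuted f \<sigma> x1 x2 x3 x4 =
     (let x = (\<lambda>i. [x1, x2, x3, x4] ! (i - 1))
      in f (x (inv \<sigma> 1)) (x (inv \<sigma> 2)) (x (inv \<sigma> 3)) (x (inv \<sigma> 4)))"

text \<open>\<open>sgn_pow \<sigma> a\<close> is \<open>a\<close> to the power \<open>\<epsilon>(\<sigma>)\<close>, in additive notation.\<close>

definition sgn_pow :: "(nat \<Rightarrow> nat) \<Rightarrow> 'a::ab_group_add \<Rightarrow> 'a" where
  "sgn_pow \<sigma> a = (if sign \<sigma> = 1 then a else - a)"

definition coc_g ::
  "('b \<Rightarrow> 'b \<Rightarrow> 'b \<Rightarrow> 'b \<Rightarrow> 'a::ab_group_add) \<Rightarrow> 'b \<Rightarrow> 'b \<Rightarrow> 'b \<Rightarrow> 'b \<Rightarrow> 'a" where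
  "coc_g f x1 x2 x3 x4 =
     (\<Sum>\<sigma> | \<sigma> permutes {1..4} \<and> \<sigma> 1 < \<sigma> 2. - sgn_pow \<sigma> (permuted f \<sigma> x1 x2 x3 x4))"

definition coc_h ::
  "('b \<Rightarrow> 'b \<Rightarrow> 'b \<Rightarrow> 'b \<Rightarrow> 'a::ab_group_add) \<Rightarrow> 'b \<Rightarrow> 'b \<Rightarrow> 'b \<Rightarrow> 'b \<Rightarrow> 'a" where
  "coc_h f x1 x2 x3 x4 =
     (\<Sum>\<sigma> | \<sigma> permutes {1..4} \<and> \<sigma> 2 < \<sigma> 3. sgn_pow \<sigma> (permuted f \<sigma> x1 x2 x3 x4))"

definition coc_gamma ::
  "('b \<Rightarrow> 'b \<Rightarrow> 'b \<Rightarrow> 'b \<Rightarrow> 'a::ab_group_add) \<Rightarrow> 'b \<Rightarrow> 'b \<Rightarrow> 'b \<Rightarrow> 'b \<Rightarrow> 'a" where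
  "coc_gamma f x1 x2 x3 x4 = coc_h f x1 x2 x3 x4"

definition coc_eta ::
  "('b \<Rightarrow> 'b \<Rightarrow> 'b \<Rightarrow> 'b \<Rightarrow> 'a::ab_group_add) \<Rightarrow> 'b \<Rightarrow> 'b \<Rightarrow> 'b \<Rightarrow> 'b \<Rightarrow> 'a" where
  "coc_eta f x1 x2 x3 x4 =
     (\<Sum>\<sigma> | \<sigma> permutes {1..4} \<and> \<sigma> 3 < \<sigma> 4. - sgn_pow \<sigma> (permuted f \<sigma> x1 x2 x3 x4))"

end

theory Submission
  imports Defs
begin

text \<open>
  Write \<open>[a|b|c]\<close> for cells of the bar complex of \<open>B\<close> and \<open>*\<close> for the signed shuffle product,
  a derivation for the boundary. Up to sign, \<open>g(a, b; c |\<^sub>2 d)\<close> is the value of \<open>f\<close> on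
  \<open>[a|b] * [c] * [d]\<close>. Since \<open>[c]\<close> and \<open>[d]\<close> are cycles, evaluating \<open>f\<close> on boundaries of shuffles
  of three-cells and of \<open>[a|b] * [c|d]\<close> gives the 2-cocycle identity and the interchange law; the
  divided square of \<open>[a|b]\<close> gives \<open>g(a, b; a + b |\<^sub>2 d) = g(a, b; a |\<^sub>2 d) + g(a, b; b |\<^sub>2 d)\<close>, from
  which all conditions on the zero sections follow; symmetry in \<open>a, b\<close> is the hypothesis on \<open>f\<close>.
  The shuffle product being graded commutative, \<open>h\<close> and \<open>\<eta>\<close> are \<open>g\<close> with its arguments permuted.
\<close>

section \<open>Signed insertions\<close>

text \<open>The value of \<open>f\<close> on the signed shuffle product
  \<open>[a|b|c] * [d]\<close>. With \<open>d\<close> as first argument,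
  \<open>insert_sum3 f d\<close> is a function of three letters.\<close>

definition insert_sum3 ::
  "('b \<Rightarrow> 'b \<Rightarrow> 'b \<Rightarrow> 'b \<Rightarrow> 'a::ab_group_add) \<Rightarrow> 'b \<Rightarrow> 'b \<Rightarrow> 'b \<Rightarrow> 'b \<Rightarrow> 'a" where
  "insert_sum3 f d a b c = f a b c d - f a b d c + f a d b c - f d a b c"

definition insert_sum2 ::
  "('b \<Rightarrow> 'b \<Rightarrow> 'b \<Rightarrow> 'a::ab_group_add) \<Rightarrow> 'b \<Rightarrow> 'b \<Rightarrow> 'b \<Rightarrow> 'a" where
  "insert_sum2 p c a b = p a b c - p a c b + p c a b"

definition normalized_3cocycle ::
  "('b::ab_group_add \<Rightarrow> 'b \<Rightarrow> 'b \<Rightarrow> 'a::ab_group_add) \<Rightarrow> bool" where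
  "normalized_3cocycle p \<longleftrightarrow>
     (\<forall>a b c d. p b c d - p (a + b) c d + p a (b + c) d - p a b (c + d) + p a b c = 0) \<and>
     (\<forall>x y. p 0 x y = 0 \<and> p x 0 y = 0 \<and> p x y 0 = 0)"

text \<open>As \<open>[z]\<close> is a cycle, the boundary of \<open>[a|b|c|d] * [z]\<close> only
  involves that of \<open>[a|b|c|d]\<close>. So the relations of \<open>f\<close> along the five
  insertions of \<open>z\<close> add up to the claim; terms merging \<open>z\<close> with a
  neighbour cancel.\<close>

lemma insert_sum3_cocycle:
  fixes f :: "'b::ab_group_add \<Rightarrow> 'b \<Rightarrow> 'b \<Rightarrow> 'b \<Rightarrow> 'a::ab_group_add"
  assumes "normalized_4cocycle f"
  shows "normalized_3cocycle (insert_sum3 f z)"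
proof -
  define R where "R x1 x2 x3 x4 x5 = f x2 x3 x4 x5 - f (x1 + x2) x3 x4 x5 + f x1 (x2 + x3) x4 x5
          - f x1 x2 (x3 + x4) x5 + f x1 x2 x3 (x4 + x5) - f x1 x2 x3 x4" for x1 x2 x3 x4 x5
  have R: "R x1 x2 x3 x4 x5 = 0" for x1 x2 x3 x4 x5
    using assms by (simp add: normalized_4cocycle_def R_def)
  have "insert_sum3 f z b c d - insert_sum3 f z (a + b) c d + insert_sum3 f z a (b + c) d
      - insert_sum3 f z a b (c + d) + insert_sum3 f z a b c
    = R a b c d z - R a b c z d + R a b z c d - R a z b c d + R z a b c d" for a b c d
    by (simp add: R_def insert_sum3_def algebra_simps)
  moreover have "insert_sum3 f z 0 x y = 0" "insert_sum3 f z x 0 y = 0" "insert_sum3 f z x y 0 = 0"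
    for x y
    using assms by (simp_all add: insert_sum3_def normalized_4cocycle_def)
  ultimately show ?thesis
    unfolding normalized_3cocycle_def by (simp add: R)
qed

section \<open>Alternating kernels\<close>

text \<open>Conditions for \<open>k x x' y\<close> (first law) and \<open>- k y y' x\<close> (second
  law) to give a biextension whose zero section is alternating.\<close>

locale alternating_kernel =
  fixes k :: "'b::ab_group_add \<Rightarrow> 'b \<Rightarrow> 'b \<Rightarrow> 'a::ab_group_add"
  assumes k_sym: "k a b c = k b a c"
    and k_cocycle: "k a b z + k (a + b) c z = k b c z + k a (b + c) z"
    and k_zero [simp]: "k 0 b c = 0" "k a 0 c = 0" "k a b 0 = 0"
    and k_interchange: "k a b (c + d) - k a b c - k a b d = - (k c d (a + b) - k c d a - k c d b)"
    and k_diag: "k a b (a + b) = k a b a + k a b b"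

lemma alternating_kernel_insert_sum2:
  fixes p :: "'b::ab_group_add \<Rightarrow> 'b \<Rightarrow> 'b \<Rightarrow> 'a::ab_group_add"
  assumes p: "normalized_3cocycle p"
    and alt: "\<And>a b c. insert_sum2 p c a b = insert_sum2 p c b a"
  shows "alternating_kernel (\<lambda>a b c. - insert_sum2 p c a b)"
proof -
  define R where "R a b c d = p b c d - p (a + b) c d + p a (b + c) d - p a b (c + d) + p a b c"
    for a b c d
  have R: "R a b c d = 0" for a b c d
    using p by (simp add: normalized_3cocycle_def R_def)
  have norm: "p 0 x y = 0" "p x 0 y = 0" "p x y 0 = 0" for x y
    using p by (simp_all add: normalized_3cocycle_def)
  show ?thesis
  proof
    fix a b c d z :: 'b
    show "- insert_sum2 p c a b = - insert_sum2 p c b a"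
      by (simp add: alt)
    \<comment> \<open>The four insertions of the cycle \<open>[z]\<close> into
      \<open>[a|b|c]\<close>.\<close>
    have "- insert_sum2 p z a b + - insert_sum2 p z (a + b) c
       = - insert_sum2 p z b c + - insert_sum2 p z a (b + c)
         + (R a b c z - R a b z c + R a z b c - R z a b c)"
      by (simp add: insert_sum2_def R_def algebra_simps)
    then show "- insert_sum2 p z a b + - insert_sum2 p z (a + b) c
       = - insert_sum2 p z b c + - insert_sum2 p z a (b + c)"
      by (simp add: R)
    show "- insert_sum2 p c 0 b = 0" "- insert_sum2 p c a 0 = 0" "- insert_sum2 p 0 a b = 0"
      by (simp_all add: insert_sum2_def norm)
    \<comment> \<open>The relations run through the shuffles of \<open>[a|b]\<close> and \<open>[c|d]\<close>.\<close>
    have "- insert_sum2 p (c + d) a b - - insert_sum2 p c a b - - insert_sum2 p d a b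
      = - (- insert_sum2 p (a + b) c d - - insert_sum2 p a c d - - insert_sum2 p b c d)
        + (R a b c d - R a c b d + R c a b d + R a c d b - R c a d b + R c d a b)"
      by (simp add: insert_sum2_def R_def algebra_simps)
    then show "- insert_sum2 p (c + d) a b - - insert_sum2 p c a b - - insert_sum2 p d a b
      = - (- insert_sum2 p (a + b) c d - - insert_sum2 p a c d - - insert_sum2 p b c d)"
      by (simp add: R)
    \<comment> \<open>For \<open>c = a\<close> and \<open>d = b\<close> the previous combination of relations is \<open>2 R a b a b\<close>, and
      half of it suffices.\<close>
    have "- insert_sum2 p (a + b) a b = - insert_sum2 p a a b + - insert_sum2 p b a b + R a b a b"
      by (simp add: insert_sum2_def R_def algebra_simps)
    then show "- insert_sum2 p (a + b) a b = - insert_sum2 p a a b + - insert_sum2 p b a b"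
      by (simp add: R)
  qed
qed

section \<open>The kernel of a four-cocycle\<close>

text \<open>Peeling off 1, then 2, then 3 factors each permutation uniquely into three possibly
  trivial transpositions, which makes the 24 summands explicit.\<close>

lemma sum_permutes_1_4:
  fixes F :: "(nat \<Rightarrow> nat) \<Rightarrow> 'a::ab_group_add"
  shows "(\<Sum>\<sigma> | \<sigma> permutes {1..4}. F \<sigma>) =
    (\<Sum>b\<in>{1,2,3,4}. \<Sum>c\<in>{2,3,4}. \<Sum>d\<in>{3,4}.
       F (transpose 1 b \<circ> transpose 2 c \<circ> transpose 3 d))"
proof -
  have "{1..4} = {1,2,3,4::nat}" by auto
  then show ?thesis
    by (simp add: sum_over_permutations_insert comp_assoc)
qed

lemma sum_permutes_1_4_filter:
  fixes F :: "(nat \<Rightarrow> nat) \<Rightarrow> 'a::ab_group_add"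
  shows "(\<Sum>\<sigma> | \<sigma> permutes {1..4} \<and> P \<sigma>. F \<sigma>) =
    (\<Sum>\<sigma> | \<sigma> permutes {1..4}. if P \<sigma> then F \<sigma> else 0)"
  using sum.inter_filter[OF finite_permutations[OF finite_atLeastAtMost[of 1 4]], of F P] by simp

lemma transpose_comp3:
  "inv (transpose a b \<circ> transpose c d \<circ> transpose e f) i
     = transpose e f (transpose c d (transpose a b i))"
  "sign (transpose a b \<circ> transpose c d \<circ> transpose e f)
     = (if a = b then 1 else - 1) * (if c = d then 1 else - 1) * (if e = f then 1 else - 1)"
proof -
  show "inv (transpose a b \<circ> transpose c d \<circ> transpose e f) i
     = transpose e f (transpose c d (transpose a b i))"
    by (rule inv_f_eq) (auto simp: inj_compose)
  show "sign (transpose a b \<circ> transpose c d \<circ> transpose e f)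
     = (if a = b then 1 else - 1) * (if c = d then 1 else - 1) * (if e = f then 1 else - 1)"
    by (simp add: sign_compose permutation_compose permutation_swap_id sign_swap_id)
qed

lemmas permuted_sum = sum_permutes_1_4_filter sum_permutes_1_4 sgn_pow_def permuted_def Let_def
  transpose_comp3

text \<open>Letter \<open>i\<close> stands in position \<open>\<sigma> i\<close>, so
  \<open>\<sigma> 1 < \<sigma> 2\<close> keeps \<open>a\<close> before \<open>b\<close>: the sum
  runs over the 12 shuffles of \<open>[a|b]\<close>, \<open>[c]\<close> and
  \<open>[d]\<close>.\<close>

lemma coc_g_eq: "coc_g f a b c d = - insert_sum2 (insert_sum3 f d) c a b"
  unfolding coc_g_def permuted_sum
  by (simp add: transpose_def eval_nat_numeral insert_sum2_def insert_sum3_def algebra_simps)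

lemma coc_g_swap: "coc_g f a b c d = - coc_g f a b d c"
  by (simp add: coc_g_eq insert_sum2_def insert_sum3_def algebra_simps)

text \<open>Shuffles that differ by exchanging the two copies of \<open>c\<close> cancel. From
  \<open>coc_g_swap\<close> alone only twice the value would vanish.\<close>

lemma coc_g_self [simp]: "coc_g f a b c c = 0"
  by (simp add: coc_g_eq insert_sum2_def insert_sum3_def algebra_simps)

text \<open>Moving one letter past a two-cell leaves the sign unchanged; the minus reflects the
  opposite exponents in the definitions of \<open>g\<close> and \<open>h\<close>.\<close>

lemma coc_h_eq: "coc_h f a b c d = - coc_g f b c a d"
  unfolding coc_h_def permuted_sum
  by (simp add: transpose_def eval_nat_numeral coc_g_eq insert_sum2_def insert_sum3_def algebra_simps)

lemma coc_eta_eq: "coc_eta f a b c d = coc_g f c d a b"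
  unfolding coc_eta_def permuted_sum
  by (simp add: transpose_def eval_nat_numeral coc_g_eq insert_sum2_def insert_sum3_def algebra_simps)

text \<open>The permutations split according to whether \<open>a\<close> precedes \<open>b\<close>,
  so the hypothesis on \<open>f\<close> is exactly symmetry of \<open>g\<close> in its first two
  arguments.\<close>

lemma sum_permuted_eq:
  "(\<Sum>\<sigma> | \<sigma> permutes {1..4}. sgn_pow \<sigma> (permuted f \<sigma> a b c d)) = coc_g f b a c d - coc_g f a b c d"
  unfolding permuted_sum
  by (simp add: transpose_def eval_nat_numeral coc_g_eq insert_sum2_def insert_sum3_def algebra_simps)

section \<open>Trivialized biextensions\<close>

text \<open>Coordinates \<open>mk\<close> on an abstract carrier let one construction serve both the
  trivial torsor on pairs and the slices of the triextension with one variable fixed.\<close>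

locale trivialized_biextension = alternating_kernel k
  for k :: "'b::ab_group_add \<Rightarrow> 'b \<Rightarrow> 'b \<Rightarrow> 'a::ab_group_add" +
  fixes E :: "'e set" and act :: "'a \<Rightarrow> 'e \<Rightarrow> 'e" and base :: "'e \<Rightarrow> 'b \<times> 'b"
    and add1 add2 :: "'e \<Rightarrow> 'e \<Rightarrow> 'e" and mk :: "'a \<Rightarrow> 'b \<Rightarrow> 'b \<Rightarrow> 'e"
  assumes in_E: "e \<in> E \<longleftrightarrow> (\<exists>a x y. e = mk a x y)"
    and mk_inject: "mk a x y = mk a' x y \<Longrightarrow> a = a'"
    and base_mk [simp]: "base (mk a x y) = (x, y)"
    and act_mk [simp]: "act a' (mk a x y) = mk (a' + a) x y"
    and add1_mk [simp]: "add1 (mk a x y) (mk a' x' y) = mk (a + a' + k x x' y) (x + x') y"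
    and add2_mk [simp]: "add2 (mk a x y) (mk a' x y') = mk (a + a' - k y y' x) x (y + y')"
begin

lemma mk_in_E [simp]: "mk a x y \<in> E"
  by (auto simp: in_E)

lemma mk_eq_iff [simp]: "mk a x y = mk a' x' y' \<longleftrightarrow> a = a' \<and> x = x' \<and> y = y'"
  using mk_inject base_mk by (metis prod.inject)

lemma ball_E: "(\<forall>e\<in>E. P e) \<longleftrightarrow> (\<forall>a x y. P (mk a x y))"
  by (auto simp: in_E)

sublocale torsor_over E act base
proof
  show "\<exists>e\<in>E. base e = s" for s
    by (cases s) (metis base_mk mk_in_E)
  show "\<exists>!a. act a e = e'" if "e \<in> E" "e' \<in> E" "base e = base e'" for e e'
  proof -
    from that obtain a a' x y where "e = mk a x y" "e' = mk a' x y"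
      by (auto simp: in_E)
    then show ?thesis
      by (auto intro!: ex1I[of _ "a' - a"])
  qed
qed (auto simp: in_E add.assoc)

lemma partial_law1: "partial_law pair_comp1 add1"
  unfolding partial_law_def ball_E using k_cocycle
  by (auto simp: pair_comp1_def algebra_simps intro: k_sym split: if_splits)

lemma partial_law2: "partial_law pair_comp2 add2"
  unfolding partial_law_def ball_E using k_cocycle
  by (auto simp: pair_comp2_def algebra_simps intro: k_sym split: if_splits)

lemma add2_add1_mk:
  "add2 (add1 (mk a x y) (mk b x' y)) (add1 (mk c x y') (mk d x' y')) =
     add1 (add2 (mk a x y) (mk c x y')) (add2 (mk b x' y) (mk d x' y'))"
  using k_interchange[of x x' y y'] by (simp add: algebra_simps)

lemma interchange12: "interchange pair_comp1 add1 pair_comp2 add2"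
  unfolding interchange_def ball_E
  by (auto simp: pair_comp1_def pair_comp2_def add2_add1_mk simp del: add1_mk add2_mk
      split: if_splits)

sublocale biextension E act base add1 add2
  by standard (fact partial_law1 partial_law2 interchange12)+

section \<open>Neutral elements, inverses and the zero section\<close>

lemma mk_in_fib [simp]: "mk a x y \<in> fib x' y' \<longleftrightarrow> x = x' \<and> y = y'"
  by (auto simp: fib_def)

lemma fibE:
  assumes "e \<in> fib x y"
  obtains a where "e = mk a x y"
  using assms by (auto simp: fib_def in_E)

lemma zero1_eq [simp]: "zero1 y = mk 0 0 y"
  unfolding zero1_def by (rule the_equality) (auto elim!: fibE)

lemma zero2_eq [simp]: "zero2 x = mk 0 x 0"
  unfolding zero2_def by (rule the_equality) (auto elim!: fibE)

lemma neg1_mk [simp]: "neg1 (mk a x y) = mk (- a - k x (- x) y) (- x) y"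
  unfolding neg1_def by (rule the_equality) (auto elim!: fibE simp: algebra_simps eq_neg_iff_add_eq_0)

lemma neg2_mk [simp]: "neg2 (mk a x y) = mk (- a + k y (- y) x) x (- y)"
  unfolding neg2_def by (rule the_equality) (auto elim!: fibE simp: algebra_simps eq_neg_iff_add_eq_0)

text \<open>This says that the corrections in \<open>sum9\<close> of zero elements cancel: the left
  side comes from \<open>add1\<close>, the right side from \<open>add2\<close>.\<close>

lemma k_cube:
  "k x y (x + y + z) + k (x + y) z (x + y + z) =
     k x y x + k x y y + k x y z + k (x + y) z x + k (x + y) z y + k (x + y) z z"
proof -
  have "k x y (x + y + z) + k (x + y) z (x + y + z)
      = (k x y (x + y + z) + k (x + y) z (x + y)) + k (x + y) z z"
    using k_diag[of "x + y" z] by (simp add: add.assoc)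
  also have "k x y (x + y + z) + k (x + y) z (x + y)
      = k x y x + k x y y + k x y z + k (x + y) z x + k (x + y) z y"
    using k_interchange[of x y "x + y" z] by (simp add: k_diag algebra_simps)
  finally show ?thesis .
qed

sublocale alternating_biextension E act base add1 add2 "\<lambda>x. mk 0 x x"
proof
  fix x y z :: 'b
  show "mk 0 x x \<in> fib x x"
    by simp
  \<comment> \<open>The two inversions contribute \<open>k (- x) x (- x)\<close> and
    \<open>k (- x) x x\<close>, whose sum is \<open>k (- x) x 0 = 0\<close>.\<close>
  show "diag_neg (mk 0 (- x) (- x)) = mk 0 x x"
    using k_diag[of "- x" x] by (simp add: diag_neg_def add.commute)
  have 4: "mk 0 (u + v) (u + v) = sum4 (mk 0 u u) (mk 0 u v) (mk 0 v u) (mk 0 v v)" for u v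
    using k_diag[of u v] by (simp add: sum4_def)
  have 9: "mk 0 (x + y + z) (x + y + z) = sum9 (mk 0 x x) (mk 0 x y) (mk 0 x z)
      (mk 0 y x) (mk 0 y y) (mk 0 y z) (mk 0 z x) (mk 0 z y) (mk 0 z z)"
    using k_cube[of x y z] by (simp add: sum9_def algebra_simps)
  show "(cprod [mk 0 (x + y + z) (x + y + z), mk 0 x x, mk 0 y y, mk 0 z z],
      cprod [mk 0 (x + y) (x + y), mk 0 (x + z) (x + z), mk 0 (y + z) (y + z)]) \<in> cube_iso x y z"
    \<comment> \<open>All twelve elements are chosen with coordinate 0. \<open>9\<close> goes first
      because \<open>4\<close> would also split \<open>x + y + z\<close> into two summands.\<close>
    unfolding cube_iso_def 9 unfolding 4
    by (rule CollectI, intro exI conjI, rule refl) simp_all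
qed

end

section \<open>The triextension\<close>

lemma alternating_kernel_coc_g:
  fixes f :: "'b::ab_group_add \<Rightarrow> 'b \<Rightarrow> 'b \<Rightarrow> 'b \<Rightarrow> 'a::ab_group_add"
  assumes "normalized_4cocycle f"
    and "\<And>x1 x2 x3 x4. (\<Sum>\<sigma> | \<sigma> permutes {1..4}. sgn_pow \<sigma> (permuted f \<sigma> x1 x2 x3 x4)) = 0"
  shows "alternating_kernel (\<lambda>a b c. coc_g f a b c d)"
  unfolding coc_g_eq
proof (rule alternating_kernel_insert_sum2)
  show "normalized_3cocycle (insert_sum3 f d)"
    using assms(1) by (rule insert_sum3_cocycle)
  show "insert_sum2 (insert_sum3 f d) c a b = insert_sum2 (insert_sum3 f d) c b a" for a b c
    using assms(2)[of a b c d] unfolding sum_permuted_eq coc_g_eq by simp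
qed

locale alternating_4kernel =
  fixes g :: "'b::ab_group_add \<Rightarrow> 'b \<Rightarrow> 'b \<Rightarrow> 'b \<Rightarrow> 'a::ab_group_add"
  assumes kernel: "alternating_kernel (\<lambda>a b c. g a b c d)"
    and swap: "g a b c d = - g a b d c"
    and self [simp]: "g a b c c = 0"
begin

abbreviation "plus1 \<equiv> triv_tri1 g"
abbreviation "plus2 \<equiv> triv_tri2 (\<lambda>x1 x2 x3 x4. - g x2 x3 x1 x4)"
abbreviation "plus3 \<equiv> triv_tri3 (\<lambda>x1 x2 x3 x4. g x3 x4 x1 x2)"

sublocale alternating_kernel "\<lambda>a b c. g a b c d" for d
  by (rule kernel)

lemma determines:
  "determines_biextension (\<lambda>a b c. g a b c d) (\<lambda>a b c. - g b c a d) (\<lambda>_. 0)"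
proof -
  interpret trivialized_biextension "\<lambda>a b c. g a b c d" UNIV triv_act snd
    "triv_bi1 (\<lambda>a b c. g a b c d)" "triv_bi2 (\<lambda>a b c. - g b c a d)" "\<lambda>a x y. (a, x, y)"
    by standard (auto simp: triv_act_def triv_bi1_def triv_bi2_def)
  show ?thesis
    unfolding determines_biextension_def by (rule alternating_biextension_axioms)
qed

lemma alternating12:
  "alternating_biextension {e \<in> UNIV. snd (snd (snd e)) = z} triv_act
     (\<lambda>e. (fst (snd e), fst (snd (snd e)))) plus1 plus2 (\<lambda>x. (0, x, x, z))"
proof -
  interpret trivialized_biextension "\<lambda>a b c. g a b c z" "{e \<in> UNIV. snd (snd (snd e)) = z}"
    triv_act "\<lambda>e. (fst (snd e), fst (snd (snd e)))" plus1 plus2 "\<lambda>a x y. (a, x, y, z)"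
    by standard (auto simp: triv_act_def triv_tri1_def triv_tri2_def)
  show ?thesis
    by (rule alternating_biextension_axioms)
qed

text \<open>\<open>swap\<close> moves the fixed first coordinate \<open>x\<close> into the last slot
  of \<open>g\<close>, which restores the sign pattern of a trivialized biextension.\<close>

lemma alternating23:
  "alternating_biextension {e \<in> UNIV. fst (snd e) = x} triv_act
     (\<lambda>e. snd (snd e)) plus2 plus3 (\<lambda>z. (0, x, z, z))"
proof -
  interpret trivialized_biextension "\<lambda>a b c. g a b c x" "{e \<in> UNIV. fst (snd e) = x}"
    triv_act "\<lambda>e. snd (snd e)" plus2 plus3 "\<lambda>a y z. (a, x, y, z)"
    by standard (auto simp: triv_act_def triv_tri2_def triv_tri3_def swap[of _ _ x])
  show ?thesis
    by (rule alternating_biextension_axioms)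
qed

section \<open>The torsor and its three compatible laws\<close>

sublocale torsor_over UNIV triv_act "snd :: 'a \<times> 'b \<times> 'b \<times> 'b \<Rightarrow> 'b \<times> 'b \<times> 'b"
proof
  show "\<exists>!a. triv_act a e = e'" if "snd e = snd e'" for e e' :: "'a \<times> 'b \<times> 'b \<times> 'b"
    using that by (cases e; cases e') (auto simp: triv_act_def intro!: ex1I[of _ "fst e' - fst e"])
qed (auto simp: triv_act_def add.assoc)

sublocale triextension UNIV triv_act snd plus1 plus2 plus3
proof
  show "partial_law triple_comp1 plus1"
    using k_cocycle unfolding partial_law_def
    by (auto simp: triple_comp1_def triv_tri1_def triv_act_def algebra_simps intro: k_sym
        split: if_splits)
  show "partial_law triple_comp2 plus2"
    using k_cocycle unfolding partial_law_def
    by (auto simp: triple_comp2_def triv_tri2_def triv_act_def algebra_simps intro: k_sym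
        split: if_splits)
  show "partial_law triple_comp3 plus3"
    using k_cocycle unfolding partial_law_def
    by (auto simp: triple_comp3_def triv_tri3_def triv_act_def algebra_simps intro: k_sym
        split: if_splits)
  have 12: "plus2 (plus1 (a, x, y, z) (b, x', y, z)) (plus1 (c, x, y', z) (d, x', y', z)) =
     plus1 (plus2 (a, x, y, z) (c, x, y', z)) (plus2 (b, x', y, z) (d, x', y', z))"
    for a b c d x x' y y' z
    using k_interchange[of x x' y y' z] by (simp add: triv_tri1_def triv_tri2_def algebra_simps)
  then show "interchange triple_comp1 plus1 triple_comp2 plus2"
    unfolding interchange_def
    by (auto simp: triple_comp1_def triple_comp2_def split: if_splits)
  \<comment> \<open>The coordinate \<open>y\<close> shared by all four elements must be the last
    argument of \<open>g\<close>; \<open>swap\<close> brings it there.\<close>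
  have 13: "plus3 (plus1 (a, x, y, z) (b, x', y, z)) (plus1 (c, x, y, z') (d, x', y, z')) =
     plus1 (plus3 (a, x, y, z) (c, x, y, z')) (plus3 (b, x', y, z) (d, x', y, z'))"
    for a b c d x x' y z z'
    using k_interchange[of x x' z z' y]
    by (simp add: triv_tri1_def triv_tri3_def swap[of _ _ y] algebra_simps)
  then show "interchange triple_comp1 plus1 triple_comp3 plus3"
    unfolding interchange_def
    by (auto simp: triple_comp1_def triple_comp3_def split: if_splits)
  have 23: "plus3 (plus2 (a, x, y, z) (b, x, y', z)) (plus2 (c, x, y, z') (d, x, y', z')) =
     plus2 (plus3 (a, x, y, z) (c, x, y, z')) (plus3 (b, x, y', z) (d, x, y', z'))"
    for a b c d x y y' z z'
    using k_interchange[of y y' z z' x]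
    by (simp add: triv_tri2_def triv_tri3_def swap[of _ _ x] algebra_simps)
  then show "interchange triple_comp2 plus2 triple_comp3 plus3"
    unfolding interchange_def
    by (auto simp: triple_comp2_def triple_comp3_def split: if_splits)
qed

lemma mem_fib [simp]: "(a, s) \<in> fib x y z \<longleftrightarrow> s = (x, y, z)"
  by (auto simp: fib_def)

lemma fibE:
  assumes "e \<in> fib x y z"
  obtains a where "e = (a, x, y, z)"
  using assms by (cases e) (auto simp: fib_def)

section \<open>Contracted products of two fibres\<close>

lemma cprod_pair: "cprod [(a, s), (b, s')] = {[(a + c, s), (b - c, s')] |c. True}"
  (is "?L = ?R")
proof
  show "?L \<subseteq> ?R"
  proof
    fix l assume "l \<in> ?L"
    then obtain as where as: "length as = length [(a, s), (b, s')]" "sum_list as = 0"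
      "l = map2 triv_act as [(a, s), (b, s')]"
      unfolding cprod_def by blast
    then obtain c d where "as = [c, d]" "c + d = 0"
      by (auto simp: length_Suc_conv)
    then show "l \<in> ?R"
      using as(3) by (auto simp: triv_act_def algebra_simps eq_neg_iff_add_eq_0 intro!: exI[of _ c])
  qed
  show "?R \<subseteq> ?L"
    unfolding cprod_def
  proof clarify
    fix c
    show "\<exists>as. [(a + c, s), (b - c, s')] = map2 triv_act as [(a, s), (b, s')] \<and>
        length as = length [(a, s), (b, s')] \<and> sum_list as = 0"
      by (rule exI[of _ "[c, - c]"]) (simp add: triv_act_def add.commute)
  qed
qed

text \<open>The orbit of a pair remembers the ordered base points and only the sum of the two
  coordinates.\<close>

lemma cprod_pair_eq_iff:
  "cprod [(a, s), (b, r)] = cprod [(a', s'), (b', r')] \<longleftrightarrow> a + b = a' + b' \<and> s = s' \<and> r = r'"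
proof
  assume L: "cprod [(a, s), (b, r)] = cprod [(a', s'), (b', r')]"
  have "[(a, s), (b, r)] \<in> cprod [(a, s), (b, r)]"
    unfolding cprod_pair by (auto intro!: exI[of _ 0])
  then show "a + b = a' + b' \<and> s = s' \<and> r = r'"
    unfolding L unfolding cprod_pair by auto
next
  assume R: "a + b = a' + b' \<and> s = s' \<and> r = r'"
  then have b: "b = a' + b' - a"
    by (simp add: algebra_simps)
  show "cprod [(a, s), (b, r)] = cprod [(a', s'), (b', r')]"
    unfolding cprod_pair b using R
    by (auto simp: algebra_simps intro: exI[of _ "_ + (a - a')"] exI[of _ "_ + (a' - a)"])
qed

lemma cdiv_cprod [simp]: "cdiv (cprod [d, e]) e = d"
  unfolding cdiv_def by (cases d; cases e) (auto intro!: the_equality simp: cprod_pair_eq_iff)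

text \<open>The corrections of the two laws cancel by \<open>k_diag\<close>, so \<open>s1\<close> of
  the zero section is the class with \<open>a + b = 0\<close>.\<close>

lemma decomposition12:
  "plus1 (plus2 (0, x, x, z) (a, x, y, z)) (plus2 (b, y, x, z) (0, y, y, z)) =
     (a + b, x + y, x + y, z)"
  using k_diag[of x y z] by (simp add: triv_tri1_def triv_tri2_def algebra_simps)

lemma decomposition23:
  "plus2 (plus3 (0, x, y, y) (a, x, y, z)) (plus3 (b, x, z, y) (0, x, z, z)) =
     (a + b, x, y + z, y + z)"
  using k_diag[of y z x]
  by (simp add: triv_tri2_def triv_tri3_def swap[of y z x] algebra_simps)

lemma s1_zero: "s1 (\<lambda>x z. (0, x, x, z)) x y z = cprod [(0, x, y, z), (0, y, x, z)]"
  unfolding s1_def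
proof (rule the_equality)
  show "\<exists>u\<in>fib x y z. \<exists>v\<in>fib y x z. cprod [(0, x, y, z), (0, y, x, z)] = cprod [u, v] \<and>
      (0, x + y, x + y, z) = plus1 (plus2 (0, x, x, z) u) (plus2 v (0, y, y, z))"
    by (rule bexI[of _ "(0, x, y, z)"], rule bexI[of _ "(0, y, x, z)"]) (simp_all add: decomposition12)
next
  fix c
  assume "\<exists>u\<in>fib x y z. \<exists>v\<in>fib y x z. c = cprod [u, v] \<and>
      (0, x + y, x + y, z) = plus1 (plus2 (0, x, x, z) u) (plus2 v (0, y, y, z))"
  then show "c = cprod [(0, x, y, z), (0, y, x, z)]"
    by (elim bexE conjE fibE) (simp add: decomposition12 cprod_pair_eq_iff)
qed

lemma s2_zero: "s2 (\<lambda>x z. (0, x, z, z)) x y z = cprod [(0, x, y, z), (0, x, z, y)]"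
  unfolding s2_def
proof (rule the_equality)
  show "\<exists>u\<in>fib x y z. \<exists>v\<in>fib x z y. cprod [(0, x, y, z), (0, x, z, y)] = cprod [u, v] \<and>
      (0, x, y + z, y + z) = plus2 (plus3 (0, x, y, y) u) (plus3 v (0, x, z, z))"
    by (rule bexI[of _ "(0, x, y, z)"], rule bexI[of _ "(0, x, z, y)"]) (simp_all add: decomposition23)
next
  fix c
  assume "\<exists>u\<in>fib x y z. \<exists>v\<in>fib x z y. c = cprod [u, v] \<and>
      (0, x, y + z, y + z) = plus2 (plus3 (0, x, y, y) u) (plus3 v (0, x, z, z))"
  then show "c = cprod [(0, x, y, z), (0, x, z, y)]"
    by (elim bexE conjE fibE) (simp add: decomposition23 cprod_pair_eq_iff)
qed

sublocale alternating_triextension UNIV triv_act snd plus1 plus2 plus3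
  "\<lambda>x z. (0, x, x, z)" "\<lambda>x z. (0, x, z, z)"
proof (intro alternating_triextension.intro triextension_axioms
    alternating_triextension_axioms.intro)
  fix x y :: 'b
  show "cdiv (s1 (\<lambda>x z. (0, x, x, z)) x y x) (0, y, x, x)
      = cdiv (s2 (\<lambda>x z. (0, x, z, z)) x y x) (0, x, x, y)"
    \<comment> \<open>Both quotients are \<open>(0, x, y, x)\<close>.\<close>
    by (simp add: s1_zero s2_zero)
\<comment> \<open>Additivity of the two sections reduces to \<open>g z z' x x = 0\<close> and
  \<open>g x x' z z = 0\<close>, that is, to \<open>self\<close>.\<close>
qed (fact alternating12 alternating23 | simp add: triv_tri1_def triv_tri3_def)+

end

theorem proposition8p2:
  fixes f :: "'b::ab_group_add \<Rightarrow> 'b \<Rightarrow> 'b \<Rightarrow> 'b \<Rightarrow> 'a::ab_group_add"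
  assumes "normalized_4cocycle f"
    and "\<And>x1 x2 x3 x4. (\<Sum>\<sigma> | \<sigma> permutes {1..4}. sgn_pow \<sigma> (permuted f \<sigma> x1 x2 x3 x4)) = 0"
  shows
    "(\<forall>x4. determines_biextension
        (\<lambda>x1 x2 x3. coc_g f x1 x2 x3 x4) (\<lambda>x1 x2 x3. coc_h f x1 x2 x3 x4) (\<lambda>_. 0)) \<and>
     (\<forall>x1. determines_biextension
        (\<lambda>x2 x3 x4. coc_gamma f x1 x2 x3 x4) (\<lambda>x2 x3 x4. coc_eta f x1 x2 x3 x4) (\<lambda>_. 0)) \<and>
     alternating_triextension UNIV triv_act snd
       (triv_tri1 (coc_g f)) (triv_tri2 (coc_h f)) (triv_tri3 (coc_eta f))
       (\<lambda>x z. (0, x, x, z)) (\<lambda>x z. (0, x, z, z))"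
proof -
  interpret alternating_4kernel "coc_g f"
    using alternating_kernel_coc_g[OF assms] coc_g_swap coc_g_self
    by (rule alternating_4kernel.intro)
  have h: "coc_h f = (\<lambda>x1 x2 x3 x4. - coc_g f x2 x3 x1 x4)"
    and eta: "coc_eta f = (\<lambda>x1 x2 x3 x4. coc_g f x3 x4 x1 x2)"
    by (intro ext coc_h_eq coc_eta_eq)+
  \<comment> \<open>By antisymmetry in the last two arguments, the second triple has the form of the
    first with \<open>x1\<close> as its fixed variable.\<close>
  have gamma: "coc_gamma f x1 = (\<lambda>a b c. coc_g f a b c x1)"
    and eta': "coc_eta f x1 = (\<lambda>a b c. - coc_g f b c a x1)" for x1
    using coc_g_swap[of f _ _ x1] by (simp_all add: fun_eq_iff coc_gamma_def h eta)
  have "alternating_triextension UNIV triv_act snd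
       (triv_tri1 (coc_g f)) (triv_tri2 (coc_h f)) (triv_tri3 (coc_eta f))
       (\<lambda>x z. (0, x, x, z)) (\<lambda>x z. (0, x, z, z))"
    unfolding h eta by (rule alternating_triextension_axioms)
  moreover have "determines_biextension
      (\<lambda>x1 x2 x3. coc_g f x1 x2 x3 x4) (\<lambda>x1 x2 x3. coc_h f x1 x2 x3 x4) (\<lambda>_. 0)" for x4
    unfolding h by (rule determines)
  moreover have "determines_biextension (coc_gamma f x1) (coc_eta f x1) (\<lambda>_. 0)" for x1
    unfolding gamma eta' by (rule determines)
  ultimately show ?thesis
    by blast
qed

end
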